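(* Let $n\ge2$ and let $\mathcal M$, $\mathcal N$, $\nu$ be as in the context. Then for every $a\in\mathcal M$ the sequence $\nu(a)$ is a one-column PBW-semistandard tableau, and the map $\tau:\mathcal M\to\mathcal N$, $a\mapsto b_{\nu(a)}$, is an isomorphism of posets.
   Context: $\mathcal M$ is the set of symbols $a_{i_1,\ldots,i_k}$, $1\le k\le n-1$, $1\le i_1<\dots<i_k\le n$, ordered by $a_{i_1,\ldots,i_k}\le a_{j_1,\ldots,j_l}$ iff $k\ge l$ and $i_r\le j_r$ for $1\le r\le l$. A one-column tableau $(\alpha_1,\ldots,\alpha_k)$ with entries in $[1,n]$ is PBW-semistandard if $\alpha_r\le k$ implies $\alpha_r=r$, and whenever $r_1<r_2$ with $\alpha_{r_1}>k$ and $\alpha_{r_2}>k$ we have $\alpha_{r_1}>\alpha_{r_2}$. A two-column tableau with columns $(\alpha_1,\ldots,\alpha_k)$ and $(\beta_1,\ldots,\beta_l)$ (in this order), $k\ge l$, is PBW-semistandard if both columns are and for every $r\in[1,l]$ there is $s\ge r$ with $\alpha_s\ge\beta_r$. $\mathcal N$ is the set of symbols $b_{\alpha_1,\ldots,\alpha_k}$, $1\le k\le n-1$, $(\alpha_1,\ldots,\alpha_k)$ a one-column PBW-semistandard tableau, ordered by $b_{\beta_1,\ldots,\beta_l}\le b_{\alpha_1,\ldots,\alpha_k}$ iff the two-column tableau with columns $(\alpha_1,\ldots,\alpha_k)$, $(\beta_1,\ldots,\beta_l)$ is PBW-semistandard. Let $P=\{(r,s):1\le r\le s\le n\}\setminus\{(1,1),(n,n)\}$;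 for $(r,s)\in P$ let $y_{r,s}=a_{\gamma_1,\ldots,\gamma_m}$ where $\{\gamma_1<\dots<\gamma_m\}=[1,n]\setminus[n-s+1,n+r-s]$. For $a\in\mathcal M$ let $J(a)=\{(r,s)\in P:y_{r,s}\le a\}$, let $\kappa$ be the largest $i$ with $(i,i)\in J(a)$ (and $\kappa=1$ if there is none), and let $(r_1,s_1),\ldots,(r_m,s_m)$ be the maximal elements of $J(a)$ (for the order $(r,s)\le(u,v)$ iff $r\le u$, $s\le v$) with $r_j<s_j$. Then $\nu(a)$ is the sequence obtained from $(1,2,\ldots,\kappa)$ by replacing each entry $r_j$ by $s_j$. *)

theory Defs
  imports Main
begin

text \<open>
  The symbols \<open>a\<^bsub>i\<^sub>1,\<dots>,i\<^sub>k\<^esub>\<close> and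
  \<open>b\<^bsub>\<alpha>\<^sub>1,\<dots>,\<alpha>\<^sub>k\<^esub>\<close> are identified with their
  index sequences, given as lists. Sequences are numbered from 1 in the mathematics and lists
  from 0, so \<open>entry\<close> provides the access used throughout.
\<close>

definition entry :: "nat list \<Rightarrow> nat \<Rightarrow> nat" where
  "entry xs r = xs ! (r - 1)"

definition M_set :: "nat \<Rightarrow> nat list set" where
  "M_set n = {a. 1 \<le> length a \<and> length a \<le> n - 1 \<and> set a \<subseteq> {1..n} \<and> sorted_wrt (<) a}"

definition M_le :: "nat list \<Rightarrow> nat list \<Rightarrow> bool" where
  "M_le a b \<longleftrightarrow> length b \<le> length a \<and> (\<forall>r\<in>{1..length b}. entry a r \<le> entry b r)"

definition pbw_column :: "nat \<Rightarrow> nat list \<Rightarrow> bool" where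
  "pbw_column n \<alpha> \<longleftrightarrow>
     set \<alpha> \<subseteq> {1..n} \<and>
     (\<forall>r\<in>{1..length \<alpha>}. entry \<alpha> r \<le> length \<alpha> \<longrightarrow> entry \<alpha> r = r) \<and>
     (\<forall>r1\<in>{1..length \<alpha>}. \<forall>r2\<in>{1..length \<alpha>}.
        r1 < r2 \<and> entry \<alpha> r1 > length \<alpha> \<and> entry \<alpha> r2 > length \<alpha>
          \<longrightarrow> entry \<alpha> r1 > entry \<alpha> r2)"

definition pbw_two_columns :: "nat \<Rightarrow> nat list \<Rightarrow> nat list \<Rightarrow> bool" where
  "pbw_two_columns n \<alpha> \<beta> \<longleftrightarrow>
     length \<beta> \<le> length \<alpha> \<and> pbw_column n \<alpha> \<and> pbw_column n \<beta> \<and>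
     (\<forall>r\<in>{1..length \<beta>}. \<exists>s\<in>{r..length \<alpha>}. entry \<alpha> s \<ge> entry \<beta> r)"

definition N_set :: "nat \<Rightarrow> nat list set" where
  "N_set n = {\<alpha>. 1 \<le> length \<alpha> \<and> length \<alpha> \<le> n - 1 \<and> pbw_column n \<alpha>}"

text \<open>The larger symbol is the left column.\<close>

definition N_le :: "nat \<Rightarrow> nat list \<Rightarrow> nat list \<Rightarrow> bool" where
  "N_le n \<beta> \<alpha> \<longleftrightarrow> pbw_two_columns n \<alpha> \<beta>"

definition M_ord :: "nat \<Rightarrow> nat list rel" where
  "M_ord n = {(a, b). a \<in> M_set n \<and> b \<in> M_set n \<and> M_le a b}"

definition N_ord :: "nat \<Rightarrow> nat list rel" where
  "N_ord n = {(a, b). a \<in> N_set n \<and> b \<in> N_set n \<and> N_le n a b}"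

definition P_set :: "nat \<Rightarrow> (nat \<times> nat) set" where
  "P_set n = {(r, s). 1 \<le> r \<and> r \<le> s \<and> s \<le> n} - {(1, 1), (n, n)}"

definition P_le :: "nat \<times> nat \<Rightarrow> nat \<times> nat \<Rightarrow> bool" where
  "P_le p q \<longleftrightarrow> fst p \<le> fst q \<and> snd p \<le> snd q"

definition y_elem :: "nat \<Rightarrow> nat \<Rightarrow> nat \<Rightarrow> nat list" where
  "y_elem n r s = sorted_list_of_set ({1..n} - {n - s + 1..n + r - s})"

definition J_set :: "nat \<Rightarrow> nat list \<Rightarrow> (nat \<times> nat) set" where
  "J_set n a = {(r, s). (r, s) \<in> P_set n \<and> M_le (y_elem n r s) a}"

definition kappa :: "nat \<Rightarrow> nat list \<Rightarrow> nat" where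
  "kappa n a =
     (if \<exists>i. (i, i) \<in> J_set n a then Max {i. (i, i) \<in> J_set n a} else 1)"

definition max_offdiag :: "nat \<Rightarrow> nat list \<Rightarrow> (nat \<times> nat) set" where
  "max_offdiag n a =
     {(r, s). (r, s) \<in> J_set n a \<and> (\<forall>q\<in>J_set n a. P_le (r, s) q \<longrightarrow> q = (r, s)) \<and> r < s}"

text \<open>
  Distinct maximal elements are incomparable, hence have distinct first components, so the
  definite description below is well defined.
\<close>

definition nu :: "nat \<Rightarrow> nat list \<Rightarrow> nat list" where
  "nu n a =
     map (\<lambda>i. if \<exists>s. (i, s) \<in> max_offdiag n a then THE s. (i, s) \<in> max_offdiag n a else i)
       [1..<kappa n a + 1]"

definition poset_iso :: "'a set \<Rightarrow> 'a rel \<Rightarrow> 'b set \<Rightarrow> 'b rel \<Rightarrow> ('a \<Rightarrow> 'b) \<Rightarrow> bool" where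
  "poset_iso A R B S f \<longleftrightarrow>
     partial_order_on A R \<and> partial_order_on B S \<and> bij_betw f A B \<and>
     (\<forall>x\<in>A. \<forall>y\<in>A. (x, y) \<in> R \<longleftrightarrow> (f x, f y) \<in> S)"

end

theory Submission
  imports Defs
begin

text \<open>
  Both posets embed into the order ideals of the triangle \<open>{(r, s). 1 \<le> r \<le> s \<le> n}\<close>,
  ordered by inclusion. On the \<open>\<M>\<close> side, comparing \<open>y\<^bsub>r,s\<^esub>\<close> with
  \<open>a\<close> only involves the entry of \<open>a\<close> at position \<open>n - s + 1\<close>, because
  \<open>a\<^sub>j - j\<close> is weakly increasing; hence \<open>a\<close> can be read off from \<open>J(a)\<close>, to
  which we add the point \<open>(1, 1)\<close>. On the \<open>\<N>\<close> side, a column \<open>\<alpha>\<close>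
  corresponds to the ideal generated by the points \<open>(t, \<alpha>\<^sub>t)\<close>, and the
  PBW-semistandard conditions say that \<open>\<alpha>\<close> lists the maximal elements of this ideal. The
  map \<open>\<nu>\<close> translates one description of the same ideal into the other.
\<close>

text \<open>The disjunct \<open>s + length a \<le> n\<close> says that position
  \<open>n - s + 1\<close> lies beyond the end of \<open>a\<close>, so that there is no entry to
  test. Unlike \<open>P_set\<close>, the triangle keeps its corners \<open>(1, 1)\<close> and
  \<open>(n, n)\<close>.\<close>

definition M_ideal :: "nat \<Rightarrow> nat list \<Rightarrow> (nat \<times> nat) set" where
  "M_ideal n a = {(r, s). 1 \<le> r \<and> r \<le> s \<and> s \<le> n \<and> r + length a \<le> n \<and>
     (s + length a \<le> n \<or> n - s + 1 + r \<le> entry a (n - s + 1))}"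

definition N_ideal :: "nat \<Rightarrow> nat list \<Rightarrow> (nat \<times> nat) set" where
  "N_ideal n \<alpha> = {(r, s). 1 \<le> r \<and> r \<le> s \<and> s \<le> n \<and>
     (\<exists>t\<in>{r..length \<alpha>}. s \<le> entry \<alpha> t)}"

lemma entry_in_set: "1 \<le> r \<Longrightarrow> r \<le> length xs \<Longrightarrow> entry xs r \<in> set xs"
  by (simp add: entry_def)

lemma list_eq_entryI:
  assumes "length xs = length ys"
    and "\<And>r. 1 \<le> r \<Longrightarrow> r \<le> length ys \<Longrightarrow> entry xs r = entry ys r"
  shows "xs = ys"
proof (rule nth_equalityI[OF assms(1)])
  fix i assume "i < length xs"
  then show "xs ! i = ys ! i"
    using assms(1) assms(2)[of "Suc i"] by (simp add: entry_def)
qed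

lemma entry_map_upt:
  assumes "1 \<le> r" "r \<le> k"
  shows "entry (map f [1..<k + 1]) r = f r"
  using assms by (simp add: entry_def del: upt_Suc)

section \<open>Increasing sequences and their ideals\<close>

lemma M_setD:
  assumes "a \<in> M_set n"
  shows "1 \<le> length a" "length a < n"
    and "\<And>r. 1 \<le> r \<Longrightarrow> r \<le> length a \<Longrightarrow> 1 \<le> entry a r \<and> entry a r \<le> n"
proof -
  show "1 \<le> length a" "length a < n"
    using assms by (auto simp: M_set_def)
  fix r assume "1 \<le> r" "r \<le> length a"
  then show "1 \<le> entry a r \<and> entry a r \<le> n"
    using entry_in_set[of r a] assms by (auto simp: M_set_def)
qed

text \<open>Each step of \<open>a\<close> rises by at least 1, so the excess
  \<open>entry a j - j\<close> never falls. The form with sums avoids truncated subtraction.\<close>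

lemma sorted_entry_gap:
  assumes "sorted_wrt (<) a" "1 \<le> i" "i \<le> j" "j \<le> length a"
  shows "entry a i + j \<le> entry a j + i"
  using assms(3,4)
proof (induction j rule: dec_induct)
  case (step m)
  have "entry a m < entry a (Suc m)"
    using assms(1,2) step by (auto simp: entry_def intro: sorted_wrt_nth_less)
  then show ?case
    using step by auto
qed simp

lemma M_entry_ge:
  assumes "a \<in> M_set n" "1 \<le> j" "j \<le> length a"
  shows "j \<le> entry a j"
  using sorted_entry_gap[of a 1 j] M_setD(3)[OF assms(1), of 1] assms
  by (auto simp: M_set_def)

lemma M_entry_le:
  assumes "a \<in> M_set n" "1 \<le> j" "j \<le> length a"
  shows "entry a j + length a \<le> n + j"
  using sorted_entry_gap[of a j "length a"] M_setD(3)[OF assms(1), of "length a"] assms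
  by (auto simp: M_set_def)

lemma y_elem_eq:
  assumes "1 \<le> r" "r \<le> s" "s \<le> n"
  shows "y_elem n r s = [1..<n - s + 1] @ [n + r - s + 1..<n + 1]"
proof -
  let ?l = "[1..<n - s + 1] @ [n + r - s + 1..<n + 1]"
  have "set ?l = {1..n} - {n - s + 1..n + r - s}"
    using assms by auto
  moreover have "sorted ?l" "distinct ?l"
    using assms by (auto simp: sorted_append)
  ultimately show ?thesis
    unfolding y_elem_def by (metis sorted_list_of_set.idem_if_sorted_distinct)
qed

text \<open>Up to position \<open>n - s\<close> the sequence \<open>y_elem n r s\<close> is the
  identity, which \<open>M_entry_ge\<close> bounds for free; afterwards it is the identity shifted
  by \<open>r\<close>. As the excess of \<open>a\<close> never falls, the first shifted position, if
  \<open>a\<close> reaches it, decides all later ones.\<close>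

lemma y_elem_le_iff:
  assumes a: "a \<in> M_set n" and rs: "1 \<le> r" "r \<le> s" "s \<le> n"
  shows "M_le (y_elem n r s) a \<longleftrightarrow> (r, s) \<in> M_ideal n a"
proof -
  let ?y = "y_elem n r s"
  have len: "length ?y = n - r"
    using rs by (simp add: y_elem_eq del: upt_Suc)
  have low: "entry ?y j = j" if "1 \<le> j" "j \<le> n - s" for j
    using rs that by (auto simp: y_elem_eq entry_def nth_append simp del: upt_Suc)
  have high: "entry ?y j = j + r" if "n - s < j" "j \<le> n - r" for j
    using rs that by (auto simp: y_elem_eq entry_def nth_append simp del: upt_Suc)
  show ?thesis
  proof
    assume le: "M_le ?y a"
    then have "length a \<le> n - r"
      by (simp add: M_le_def len)
    moreover have "n - s + 1 + r \<le> entry a (n - s + 1)" if "\<not> s + length a \<le> n"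
    proof -
      have "entry ?y (n - s + 1) \<le> entry a (n - s + 1)"
        using le that rs by (auto simp: M_le_def)
      then show ?thesis
        using high[of "n - s + 1"] that \<open>length a \<le> n - r\<close> rs by simp
    qed
    ultimately show "(r, s) \<in> M_ideal n a"
      using rs by (auto simp: M_ideal_def)
  next
    assume I: "(r, s) \<in> M_ideal n a"
    then have k: "length a \<le> n - r"
      by (auto simp: M_ideal_def)
    have "entry ?y j \<le> entry a j" if j: "1 \<le> j" "j \<le> length a" for j
    proof (cases "j \<le> n - s")
      case True
      then show ?thesis using low M_entry_ge[OF a] j by simp
    next
      case False
      then have "n - s + 1 + r \<le> entry a (n - s + 1)"
        using I j by (auto simp: M_ideal_def)
      moreover have "entry a (n - s + 1) + j \<le> entry a j + (n - s + 1)"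
        using a False j by (intro sorted_entry_gap) (auto simp: M_set_def)
      ultimately show ?thesis
        using high[of j] False j k by simp
    qed
    then show "M_le ?y a"
      using k by (auto simp: M_le_def len)
  qed
qed

text \<open>Of the two corners missing from \<open>P_set\<close>, \<open>(n, n)\<close> is never in
  the ideal because \<open>a\<close> is nonempty, whereas \<open>(1, 1)\<close> always is and has to
  be removed.\<close>

lemma J_set_eq:
  assumes "a \<in> M_set n"
  shows "J_set n a = M_ideal n a - {(1, 1)}"
proof -
  have "(n, n) \<notin> M_ideal n a"
    using M_setD(1)[OF assms] by (auto simp: M_ideal_def)
  moreover have "(r, s) \<in> M_ideal n a \<Longrightarrow> 1 \<le> r \<and> r \<le> s \<and> s \<le> n" for r s
    by (auto simp: M_ideal_def)
  ultimately show ?thesis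
    using y_elem_le_iff[OF assms] unfolding J_set_def P_set_def by blast
qed

lemma M_ideal_diag_iff:
  assumes "a \<in> M_set n"
  shows "(i, i) \<in> M_ideal n a \<longleftrightarrow> 1 \<le> i \<and> i \<le> n - length a"
  using M_setD(2)[OF assms] by (auto simp: M_ideal_def)

lemma kappa_eq:
  assumes a: "a \<in> M_set n"
  shows "kappa n a = n - length a"
proof -
  have diag: "(i, i) \<in> J_set n a \<longleftrightarrow> 2 \<le> i \<and> i \<le> n - length a" for i
    using M_ideal_diag_iff[OF a, of i] by (auto simp: J_set_eq[OF a])
  show ?thesis
  proof (cases "2 \<le> n - length a")
    case True
    have "{i. (i, i) \<in> J_set n a} = {2..n - length a}"
      unfolding diag by auto
    then have "Max {i. (i, i) \<in> J_set n a} = n - length a"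
      using True by (auto intro: Max_eqI)
    then show ?thesis
      using True diag unfolding kappa_def by (metis order_refl)
  next
    \<comment> \<open>Here \<open>n - length a\<close> is 1: the default value of
      \<open>kappa\<close> stands in for the removed point \<open>(1, 1)\<close>.\<close>
    case False
    then have "\<nexists>i. (i, i) \<in> J_set n a"
      using diag by simp
    then show ?thesis
      using False M_setD(2)[OF a] by (simp add: kappa_def)
  qed
qed

text \<open>Lowering the second coordinate moves the tested position to the right, where the excess
  is at least as large, and lowering the first only weakens the test.\<close>

lemma M_ideal_down:
  assumes a: "a \<in> M_set n"
    and uv: "(u, v) \<in> M_ideal n a"
    and rs: "1 \<le> r" "r \<le> s" "r \<le> u" "s \<le> v"
  shows "(r, s) \<in> M_ideal n a"
proof (cases "s + length a \<le> n")
  case True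
  then show ?thesis
    using uv rs by (auto simp: M_ideal_def)
next
  case False
  have v: "v \<le> n" and u: "u + length a \<le> n"
    using uv by (auto simp: M_ideal_def)
  have "n - v + 1 + u \<le> entry a (n - v + 1)"
    using uv rs False by (auto simp: M_ideal_def)
  moreover have "entry a (n - v + 1) + (n - s + 1) \<le> entry a (n - s + 1) + (n - v + 1)"
    using a v rs False by (intro sorted_entry_gap) (auto simp: M_set_def)
  ultimately show ?thesis
    using v u rs by (auto simp: M_ideal_def)
qed

lemma M_le_iff_ideal:
  assumes a: "a \<in> M_set n" and b: "b \<in> M_set n"
  shows "M_le a b \<longleftrightarrow> M_ideal n a \<subseteq> M_ideal n b"
proof
  assume le: "M_le a b"
  then have len: "length b \<le> length a"
    by (simp add: M_le_def)
  show "M_ideal n a \<subseteq> M_ideal n b"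
  proof clarify
    fix r s assume rs: "(r, s) \<in> M_ideal n a"
    have "n - s + 1 + r \<le> entry b (n - s + 1)" if s: "\<not> s + length b \<le> n"
    proof -
      have "n - s + 1 + r \<le> entry a (n - s + 1)"
        using rs s len by (auto simp: M_ideal_def)
      also have "\<dots> \<le> entry b (n - s + 1)"
        using le s rs by (auto simp: M_le_def M_ideal_def)
      finally show ?thesis .
    qed
    then show "(r, s) \<in> M_ideal n b"
      using rs len by (auto simp: M_ideal_def)
  qed
next
  assume sub: "M_ideal n a \<subseteq> M_ideal n b"
  \<comment> \<open>The last diagonal point of the ideal encodes the length.\<close>
  have "(n - length a, n - length a) \<in> M_ideal n b"
    using sub M_ideal_diag_iff[OF a] M_setD(2)[OF a] by auto
  then have len: "length b \<le> length a"
    using M_ideal_diag_iff[OF b] M_setD(2)[OF a] M_setD(2)[OF b] by auto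
  have "entry a j \<le> entry b j" if j: "1 \<le> j" "j \<le> length b" for j
  proof (cases "entry a j = j")
    case True
    then show ?thesis using M_entry_ge[OF b j] by simp
  next
    case False
    then have "j < entry a j"
      using M_entry_ge[OF a, of j] j len by simp
    then obtain r where r: "entry a j = j + r" "1 \<le> r"
      using less_iff_Suc_add by force
    have j': "n - (n - j + 1) + 1 = j"
      using j len M_setD(2)[OF a] by simp
    \<comment> \<open>The second coordinate \<open>n - j + 1\<close> tests position
      \<open>j\<close>, and \<open>r\<close> is the exact excess of \<open>a\<close> there. The
      excess 0 is invisible to the ideal and was settled by \<open>M_entry_ge\<close>.\<close>
    have "(r, n - j + 1) \<in> M_ideal n a"
      using r j len M_entry_le[OF a, of j] M_setD(3)[OF a, of j]
      unfolding M_ideal_def by (auto simp: j')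
    then have "(r, n - j + 1) \<in> M_ideal n b"
      using sub by blast
    then show ?thesis
      using r j len M_setD(2)[OF a] unfolding M_ideal_def by (auto simp: j')
  qed
  then show "M_le a b"
    using len by (simp add: M_le_def)
qed

lemma M_le_antisym:
  assumes "M_le a b" "M_le b a"
  shows "a = b"
  using assms by (intro list_eq_entryI) (auto simp: M_le_def intro: le_antisym)

section \<open>PBW-semistandard columns and their ideals\<close>

lemma pbw_columnD:
  assumes "pbw_column n \<alpha>" "1 \<le> r" "r \<le> length \<alpha>"
  shows "r \<le> entry \<alpha> r" "entry \<alpha> r \<le> n"
proof -
  show "r \<le> entry \<alpha> r"
    using assms by (cases "entry \<alpha> r \<le> length \<alpha>") (auto simp: pbw_column_def)
  show "entry \<alpha> r \<le> n"
    using assms entry_in_set[of r \<alpha>] by (auto simp: pbw_column_def)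
qed

lemma N_le_iff_ideal:
  assumes \<beta>: "pbw_column n \<beta>" "1 \<le> length \<beta>" and \<alpha>: "pbw_column n \<alpha>"
  shows "N_le n \<beta> \<alpha> \<longleftrightarrow> N_ideal n \<beta> \<subseteq> N_ideal n \<alpha>"
proof
  assume le: "N_le n \<beta> \<alpha>"
  show "N_ideal n \<beta> \<subseteq> N_ideal n \<alpha>"
  proof clarify
    fix r s assume rs: "(r, s) \<in> N_ideal n \<beta>"
    then obtain t where t: "r \<le> t" "t \<le> length \<beta>" "s \<le> entry \<beta> t" "1 \<le> r"
      by (auto simp: N_ideal_def)
    then obtain u where "t \<le> u" "u \<le> length \<alpha>" "entry \<beta> t \<le> entry \<alpha> u"
      using le unfolding N_le_def pbw_two_columns_def
      by (metis atLeastAtMost_iff le_trans)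
    then have "u \<in> {r..length \<alpha>}" "s \<le> entry \<alpha> u"
      using t by auto
    then show "(r, s) \<in> N_ideal n \<alpha>"
      using rs by (auto simp: N_ideal_def)
  qed
next
  assume sub: "N_ideal n \<beta> \<subseteq> N_ideal n \<alpha>"
  have dom: "\<exists>s\<in>{r..length \<alpha>}. entry \<beta> r \<le> entry \<alpha> s" if r: "1 \<le> r" "r \<le> length \<beta>" for r
  proof -
    \<comment> \<open>It suffices to test the generators of the ideal of
      \<open>\<beta>\<close>.\<close>
    have "(r, entry \<beta> r) \<in> N_ideal n \<beta>"
      using r pbw_columnD[OF \<beta>(1) r] by (auto simp: N_ideal_def)
    then show ?thesis
      using sub by (auto simp: N_ideal_def)
  qed
  \<comment> \<open>Dominating the last entry of \<open>\<beta>\<close> takes a position of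
    \<open>\<alpha>\<close> that is at least \<open>length \<beta>\<close>.\<close>
  then have "length \<beta> \<le> length \<alpha>"
    using dom[OF \<beta>(2) order_refl] by auto
  then show "N_le n \<beta> \<alpha>"
    using \<alpha> \<beta> dom by (auto simp: N_le_def pbw_two_columns_def)
qed

lemma pbw_large_entry_eq:
  assumes \<alpha>: "pbw_column n \<alpha>" and le: "N_le n \<alpha> \<beta>" "N_le n \<beta> \<alpha>"
    and r: "1 \<le> r" "r \<le> length \<alpha>" and big: "length \<alpha> < entry \<alpha> r"
  shows "entry \<beta> r = entry \<alpha> r"
proof -
  obtain t where t: "r \<le> t" "t \<le> length \<beta>" "entry \<alpha> r \<le> entry \<beta> t"
    using le(1) r unfolding N_le_def pbw_two_columns_def by force
  obtain u where u: "t \<le> u" "u \<le> length \<alpha>" "entry \<beta> t \<le> entry \<alpha> u"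
    using le(2) r t unfolding N_le_def pbw_two_columns_def
    by (metis atLeastAtMost_iff le_trans)
  \<comment> \<open>The entries exceeding the length decrease strictly, so going to \<open>\<beta>\<close> and back ends at \<open>r\<close>.\<close>
  have "u = r"
  proof (rule ccontr)
    assume "u \<noteq> r"
    then have "r < u" "length \<alpha> < entry \<alpha> u"
      using t u big by auto
    then have "entry \<alpha> u < entry \<alpha> r"
      using \<alpha> r u big by (auto simp: pbw_column_def)
    then show False
      using t u by simp
  qed
  then show ?thesis
    using t u by auto
qed

text \<open>The lengths agree. Where one column has an entry exceeding the length,
  \<open>pbw_large_entry_eq\<close> applies from that side; where neither does, both entries equal
  their position.\<close>

lemma N_le_antisym:
  assumes le: "N_le n \<alpha> \<beta>" "N_le n \<beta> \<alpha>"
  shows "\<alpha> = \<beta>"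
proof (rule list_eq_entryI)
  have \<alpha>: "pbw_column n \<alpha>" and \<beta>: "pbw_column n \<beta>" and len: "length \<alpha> = length \<beta>"
    using le by (auto simp: N_le_def pbw_two_columns_def)
  show "length \<alpha> = length \<beta>"
    by fact
  fix r assume r: "1 \<le> r" "r \<le> length \<beta>"
  consider "length \<alpha> < entry \<alpha> r" | "length \<beta> < entry \<beta> r"
    | "entry \<alpha> r \<le> length \<alpha>" "entry \<beta> r \<le> length \<beta>"
    by linarith
  then show "entry \<alpha> r = entry \<beta> r"
  proof cases
    case 1
    then show ?thesis using pbw_large_entry_eq[OF \<alpha> le] r len by simp
  next
    case 2
    then show ?thesis using pbw_large_entry_eq[OF \<beta> le(2,1)] r by simp
  next
    case 3
    then show ?thesis using \<alpha> \<beta> r len by (auto simp: pbw_column_def)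
  qed
qed

section \<open>The map \<open>nu\<close> and its ideal\<close>

lemma max_offdiag_iff:
  assumes "a \<in> M_set n"
  shows "(r, s) \<in> max_offdiag n a \<longleftrightarrow>
    (r, s) \<in> M_ideal n a \<and> r < s \<and> (\<forall>q\<in>M_ideal n a. P_le (r, s) q \<longrightarrow> q = (r, s))"
proof -
  \<comment> \<open>Restoring \<open>(1, 1)\<close> cannot spoil maximality, as it lies above no
    off-diagonal point.\<close>
  have "r < s \<Longrightarrow> (r, s) \<in> M_ideal n a \<Longrightarrow> \<not> P_le (r, s) (1, 1)"
    by (auto simp: P_le_def M_ideal_def)
  then show ?thesis
    unfolding max_offdiag_def J_set_eq[OF assms] by auto
qed

lemma length_nu:
  assumes "a \<in> M_set n"
  shows "length (nu n a) = n - length a"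
  by (simp add: nu_def kappa_eq[OF assms] del: upt_Suc)

lemma entry_nu_max:
  assumes a: "a \<in> M_set n" and rs: "(r, s) \<in> max_offdiag n a"
  shows "entry (nu n a) r = s"
proof -
  have "(THE s. (r, s) \<in> max_offdiag n a) = s"
  proof (rule the_equality)
    show "(r, s) \<in> max_offdiag n a"
      by fact
    \<comment> \<open>Points with equal first coordinate are comparable, so two maximal ones
      coincide.\<close>
    fix s' assume "(r, s') \<in> max_offdiag n a"
    then show "s' = s"
      using rs nat_le_linear[of s s'] unfolding max_offdiag_iff[OF a] P_le_def
      by (metis fst_conv snd_conv le_refl)
  qed
  moreover have "1 \<le> r" "r \<le> n - length a"
    using rs by (auto simp: max_offdiag_iff[OF a] M_ideal_def)
  ultimately show ?thesis
    using rs unfolding nu_def kappa_eq[OF a] by (subst entry_map_upt) auto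
qed

lemma entry_nu_other:
  assumes "a \<in> M_set n" "1 \<le> r" "r \<le> n - length a" "\<nexists>s. (r, s) \<in> max_offdiag n a"
  shows "entry (nu n a) r = r"
  using assms unfolding nu_def kappa_eq[OF assms(1)] by (subst entry_map_upt) auto

lemma entry_nu_in_ideal:
  assumes a: "a \<in> M_set n" and r: "1 \<le> r" "r \<le> n - length a"
  shows "(r, entry (nu n a) r) \<in> M_ideal n a"
proof (cases "\<exists>s. (r, s) \<in> max_offdiag n a")
  case True
  then obtain s where "(r, s) \<in> max_offdiag n a" ..
  then show ?thesis
    using entry_nu_max[OF a] by (simp add: max_offdiag_iff[OF a])
next
  case False
  then show ?thesis
    using entry_nu_other[OF a r] M_ideal_diag_iff[OF a] r by simp
qed

text \<open>Both conditions come from maximality. An off-diagonal maximal point with second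
  coordinate at most \<open>?k\<close> would lie below \<open>(?k, ?k)\<close>, so small entries
  were not replaced. Large entries come from maximal points, which are pairwise incomparable, so
  they decrease.\<close>

lemma pbw_column_nu:
  assumes a: "a \<in> M_set n"
  shows "pbw_column n (nu n a)"
proof -
  let ?k = "n - length a"
  have diag: "(?k, ?k) \<in> M_ideal n a"
    using M_ideal_diag_iff[OF a] M_setD(2)[OF a] by simp
  have small: "entry (nu n a) r = r" if r: "1 \<le> r" "r \<le> ?k" "entry (nu n a) r \<le> ?k" for r
  proof (rule entry_nu_other[OF a r(1,2)], rule notI)
    assume "\<exists>s. (r, s) \<in> max_offdiag n a"
    then obtain s where s: "(r, s) \<in> max_offdiag n a" ..
    then have "P_le (r, s) (?k, ?k)"
      using entry_nu_max[OF a s] r by (simp add: P_le_def)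
    then show False
      using s diag by (auto simp: max_offdiag_iff[OF a])
  qed
  have large: "(r, entry (nu n a) r) \<in> max_offdiag n a"
    if "1 \<le> r" "r \<le> ?k" "?k < entry (nu n a) r" for r
    using entry_nu_max[OF a] entry_nu_other[OF a that(1,2)] that by fastforce
  have decr: "entry (nu n a) r2 < entry (nu n a) r1"
    if r: "1 \<le> r1" "r1 < r2" "r2 \<le> ?k" "?k < entry (nu n a) r1" "?k < entry (nu n a) r2"
    for r1 r2
  proof (rule ccontr)
    assume "\<not> ?thesis"
    then have "P_le (r1, entry (nu n a) r1) (r2, entry (nu n a) r2)"
      using r by (simp add: P_le_def)
    then show False
      using large[of r1] large[of r2] r by (auto simp: max_offdiag_iff[OF a])
  qed
  have "set (nu n a) \<subseteq> {1..n}"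
  proof
    fix x assume "x \<in> set (nu n a)"
    then obtain i where i: "i < ?k" "x = nu n a ! i"
      by (auto simp: in_set_conv_nth length_nu[OF a])
    then have "(Suc i, x) \<in> M_ideal n a"
      using entry_nu_in_ideal[OF a, of "Suc i"] by (simp add: entry_def)
    then show "x \<in> {1..n}"
      by (auto simp: M_ideal_def)
  qed
  then show ?thesis
    using small decr by (auto simp: pbw_column_def length_nu[OF a])
qed

lemma nu_in_N_set:
  assumes a: "a \<in> M_set n"
  shows "nu n a \<in> N_set n"
  using pbw_column_nu[OF a] M_setD(1,2)[OF a] by (auto simp: N_set_def length_nu[OF a])

lemma below_maximal_in_ideal:
  assumes "p \<in> M_ideal n a"
  obtains q where "q \<in> M_ideal n a" "P_le p q" "\<forall>x\<in>M_ideal n a. P_le q x \<longrightarrow> x = q"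
proof -
  have "M_ideal n a \<subseteq> {1..n} \<times> {1..n}"
    by (auto simp: M_ideal_def)
  then have fin: "finite {q \<in> M_ideal n a. P_le p q}"
    using finite_subset by fastforce
  \<comment> \<open>The coordinate sum grows strictly along \<open>P_le\<close>, so a point above
    \<open>p\<close> that maximises it is maximal in the ideal.\<close>
  let ?f = "\<lambda>x. fst x + snd x" and ?A = "{q \<in> M_ideal n a. P_le p q}"
  have "p \<in> ?A"
    using assms by (simp add: P_le_def)
  then have "Max (?f ` ?A) \<in> ?f ` ?A"
    using fin by (intro Max_in finite_imageI) blast+
  then obtain q where q: "q \<in> ?A" "?f q = Max (?f ` ?A)"
    by auto
  then have max: "?f x \<le> ?f q" if "x \<in> ?A" for x
    using fin that by simp
  have "x = q" if x: "x \<in> M_ideal n a" "P_le q x" for x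
  proof -
    have "P_le p x"
      using q x by (auto simp: P_le_def)
    then have "fst x + snd x \<le> fst q + snd q"
      using max x by simp
    then show ?thesis
      using x by (auto simp: P_le_def prod_eq_iff)
  qed
  then show ?thesis
    using that q by blast
qed

text \<open>The generators \<open>(t, entry (nu n a) t)\<close> lie in the down-closed
  \<open>M_ideal\<close>, and conversely every maximal point of \<open>M_ideal\<close> is one of
  them.\<close>

lemma N_ideal_nu:
  assumes a: "a \<in> M_set n"
  shows "N_ideal n (nu n a) = M_ideal n a"
proof (intro equalityI subrelI)
  fix r s assume rs: "(r, s) \<in> N_ideal n (nu n a)"
  then obtain t where t: "r \<le> t" "t \<le> n - length a" "s \<le> entry (nu n a) t" "1 \<le> r" "r \<le> s"
    by (auto simp: N_ideal_def length_nu[OF a])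
  then show "(r, s) \<in> M_ideal n a"
    using M_ideal_down[OF a entry_nu_in_ideal[OF a, of t]] by simp
next
  fix r s assume rs: "(r, s) \<in> M_ideal n a"
  let ?k = "n - length a"
  obtain q where q: "q \<in> M_ideal n a" "P_le (r, s) q" "\<forall>x\<in>M_ideal n a. P_le q x \<longrightarrow> x = q"
    using below_maximal_in_ideal[OF rs] .
  obtain u v where uv: "q = (u, v)"
    by fastforce
  have u: "1 \<le> u" "u \<le> v" "u \<le> ?k"
    using q(1) by (auto simp: M_ideal_def uv)
  have "entry (nu n a) u = v"
  proof (cases "u < v")
    case True
    then show ?thesis
      using q by (intro entry_nu_max[OF a]) (simp add: max_offdiag_iff[OF a] uv)
  next
    case False
    \<comment> \<open>A maximal diagonal point leaves no further point of the ideal with first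
      coordinate \<open>u\<close> beyond it, so \<open>nu\<close> keeps \<open>u\<close> in
      place.\<close>
    then have "u = v"
      using u by simp
    then have "\<nexists>s'. (u, s') \<in> max_offdiag n a"
      using q(3) by (fastforce simp: max_offdiag_iff[OF a] uv P_le_def)
    then show ?thesis
      using entry_nu_other[OF a u(1,3)] \<open>u = v\<close> by simp
  qed
  then have "u \<in> {r..length (nu n a)}" "s \<le> entry (nu n a) u"
    using q(2) u by (auto simp: uv P_le_def length_nu[OF a])
  then show "(r, s) \<in> N_ideal n (nu n a)"
    using rs by (auto simp: N_ideal_def M_ideal_def)
qed

section \<open>Recovering a sequence from the ideal of a column\<close>

definition N_height :: "nat list \<Rightarrow> nat \<Rightarrow> nat" where
  "N_height \<alpha> s = Max (insert 0 {t \<in> {1..length \<alpha>}. s \<le> entry \<alpha> t})"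

text \<open>For \<open>length \<alpha> < s \<le> n\<close> this makes
  \<open>N_height \<alpha> s\<close> the largest \<open>r\<close> with \<open>(r, s)\<close> in
  \<open>N_ideal n \<alpha>\<close>. The inserted 0 covers the case without such
  \<open>r\<close>.\<close>

lemma N_height_ge_iff:
  assumes "1 \<le> r"
  shows "r \<le> N_height \<alpha> s \<longleftrightarrow> (\<exists>t\<in>{r..length \<alpha>}. s \<le> entry \<alpha> t)"
proof -
  let ?A = "{t \<in> {1..length \<alpha>}. s \<le> entry \<alpha> t}"
  have "r \<le> N_height \<alpha> s \<longleftrightarrow> (\<exists>t\<in>insert 0 ?A. r \<le> t)"
    unfolding N_height_def by (rule Max_ge_iff) auto
  also have "\<dots> \<longleftrightarrow> (\<exists>t\<in>{r..length \<alpha>}. s \<le> entry \<alpha> t)"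
    using assms unfolding Bex_def by (intro ex_cong1) auto
  finally show ?thesis .
qed

lemma N_height_le_length: "N_height \<alpha> s \<le> length \<alpha>"
  unfolding N_height_def by (subst Max_le_iff) auto

lemma N_height_antimono: "s \<le> s' \<Longrightarrow> N_height \<alpha> s' \<le> N_height \<alpha> s"
  unfolding N_height_def by (intro Max_mono) auto

lemma ex_M_ideal_eq_N_ideal:
  assumes \<alpha>: "\<alpha> \<in> N_set n"
  shows "\<exists>a\<in>M_set n. M_ideal n a = N_ideal n \<alpha>"
proof -
  let ?k = "length \<alpha>"
  have col: "pbw_column n \<alpha>" and k: "1 \<le> ?k" "?k < n"
    using \<alpha> by (auto simp: N_set_def)
  \<comment> \<open>Both choices are forced: the diagonal of the ideal ends at
    \<open>n - length a\<close>, which must be \<open>?k\<close>, and the excess of \<open>a\<close>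
    at position \<open>j\<close> is the largest first coordinate occurring with
    \<open>n - j + 1\<close>.\<close>
  define a where "a = map (\<lambda>j. j + N_height \<alpha> (n - j + 1)) [1..<(n - ?k) + 1]"
  have len: "length a = n - ?k"
    by (simp add: a_def del: upt_Suc)
  have ent: "entry a j = j + N_height \<alpha> (n - j + 1)" if "1 \<le> j" "j \<le> n - ?k" for j
    unfolding a_def using that by (rule entry_map_upt)
  have "sorted_wrt (<) a"
  proof (rule sorted_wrt_iff_nth_less[THEN iffD2], intro allI impI)
    fix i j assume "i < j" "j < length a"
    moreover have "N_height \<alpha> (n - Suc i + 1) \<le> N_height \<alpha> (n - Suc j + 1)"
      using \<open>i < j\<close> by (intro N_height_antimono) simp
    ultimately show "a ! i < a ! j"
      using ent[of "Suc i"] ent[of "Suc j"] k by (simp add: entry_def len)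
  qed
  moreover have "set a \<subseteq> {1..n}"
  proof
    fix x assume "x \<in> set a"
    then obtain j where "1 \<le> j" "j \<le> n - ?k" "x = j + N_height \<alpha> (n - j + 1)"
      by (auto simp: a_def simp del: upt_Suc)
    then show "x \<in> {1..n}"
      using N_height_le_length[of \<alpha> "n - j + 1"] k by simp
  qed
  ultimately have a: "a \<in> M_set n"
    using k by (auto simp: M_set_def len)
  have "(r, s) \<in> M_ideal n a \<longleftrightarrow> (r, s) \<in> N_ideal n \<alpha>"
    if rs: "1 \<le> r" "r \<le> s" "s \<le> n" for r s
  proof (cases "s \<le> ?k")
    case True
    \<comment> \<open>In this range both ideals contain the whole triangle; on the column side
      \<open>t = s\<close> is the witness.\<close>
    then have "s \<in> {r..?k}" "s \<le> entry \<alpha> s"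
      using pbw_columnD(1)[OF col, of s] rs by auto
    then show ?thesis
      using rs True k by (auto simp: M_ideal_def N_ideal_def len)
  next
    case False
    then have "(r, s) \<in> M_ideal n a \<longleftrightarrow> r \<le> ?k \<and> r \<le> N_height \<alpha> s"
      using rs k ent[of "n - s + 1"] by (auto simp: M_ideal_def len)
    also have "\<dots> \<longleftrightarrow> (r, s) \<in> N_ideal n \<alpha>"
      using rs N_height_le_length[of \<alpha> s] N_height_ge_iff[of r \<alpha> s]
      by (auto simp: N_ideal_def)
    finally show ?thesis .
  qed
  moreover have "(r, s) \<in> M_ideal n a \<or> (r, s) \<in> N_ideal n \<alpha> \<Longrightarrow> 1 \<le> r \<and> r \<le> s \<and> s \<le> n" for r s
    by (auto simp: M_ideal_def N_ideal_def)
  ultimately have "M_ideal n a = N_ideal n \<alpha>"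
    by (metis (no_types, lifting) subrelI subset_antisym)
  then show ?thesis
    using a by blast
qed

section \<open>Partial orders and the isomorphism\<close>

lemma N_set_le_iff_ideal:
  assumes "\<beta> \<in> N_set n" "\<alpha> \<in> N_set n"
  shows "N_le n \<beta> \<alpha> \<longleftrightarrow> N_ideal n \<beta> \<subseteq> N_ideal n \<alpha>"
  using assms by (intro N_le_iff_ideal) (auto simp: N_set_def)

lemma partial_order_on_M_ord: "partial_order_on (M_set n) (M_ord n)"
  unfolding partial_order_on_def preorder_on_def
proof (intro conjI)
  show "M_ord n \<subseteq> M_set n \<times> M_set n" "refl_on (M_set n) (M_ord n)"
    by (auto simp: M_ord_def refl_on_def M_le_def)
  show "trans (M_ord n)"
    \<comment> \<open>Transitivity is inherited from inclusion of ideals.\<close>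
    by (rule transI) (auto simp: M_ord_def M_le_iff_ideal)
  show "antisym (M_ord n)"
    by (rule antisymI) (auto simp: M_ord_def intro: M_le_antisym)
qed

lemma partial_order_on_N_ord: "partial_order_on (N_set n) (N_ord n)"
  unfolding partial_order_on_def preorder_on_def
proof (intro conjI)
  show "N_ord n \<subseteq> N_set n \<times> N_set n" "refl_on (N_set n) (N_ord n)"
    by (auto simp: N_ord_def refl_on_def N_set_le_iff_ideal)
  show "trans (N_ord n)"
    by (rule transI) (auto simp: N_ord_def N_set_le_iff_ideal, blast)
  show "antisym (N_ord n)"
    by (rule antisymI) (auto simp: N_ord_def intro: N_le_antisym)
qed

lemma M_le_iff_N_le_nu:
  assumes "a \<in> M_set n" "b \<in> M_set n"
  shows "M_le a b \<longleftrightarrow> N_le n (nu n a) (nu n b)"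
  using assms by (simp add: M_le_iff_ideal N_set_le_iff_ideal nu_in_N_set N_ideal_nu)

text \<open>Symbols with equal ideals are comparable both ways, hence equal by antisymmetry. In
  \<open>M_set\<close> this gives injectivity; in \<open>N_set\<close> it identifies
  \<open>\<alpha>\<close> with the image of the sequence built from its ideal.\<close>

lemma bij_betw_nu: "bij_betw (nu n) (M_set n) (N_set n)"
proof (rule bij_betw_imageI)
  show "inj_on (nu n) (M_set n)"
  proof (rule inj_onI)
    fix a b assume ab: "a \<in> M_set n" "b \<in> M_set n" "nu n a = nu n b"
    then have "M_ideal n a = M_ideal n b"
      using N_ideal_nu by metis
    then show "a = b"
      using ab by (intro M_le_antisym) (simp_all add: M_le_iff_ideal)
  qed
  have "\<alpha> \<in> nu n ` M_set n" if \<alpha>: "\<alpha> \<in> N_set n" for \<alpha>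
  proof -
    obtain a where a: "a \<in> M_set n" "M_ideal n a = N_ideal n \<alpha>"
      using ex_M_ideal_eq_N_ideal[OF \<alpha>] ..
    then have "\<alpha> = nu n a"
      using \<alpha> by (intro N_le_antisym[of n]) (simp_all add: N_set_le_iff_ideal nu_in_N_set N_ideal_nu)
    then show ?thesis
      using a by blast
  qed
  then show "nu n ` M_set n = N_set n"
    using nu_in_N_set by blast
qed

theorem theorem6p5:
  fixes n :: nat
  assumes "n \<ge> 2"
  shows "(\<forall>a\<in>M_set n. pbw_column n (nu n a)) \<and>
         poset_iso (M_set n) (M_ord n) (N_set n) (N_ord n) (nu n)"
  using pbw_column_nu partial_order_on_M_ord partial_order_on_N_ord bij_betw_nu
    M_le_iff_N_le_nu nu_in_N_set
  by (auto simp: poset_iso_def M_ord_def N_ord_def)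

end
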